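(* Let $\mathbf{t}=\langle T_*,b_*,\langle\|\cdot\|_t: t\in T_*\rangle\rangle$ be a tree-creature frame satisfying $\lim_{n\to\infty}\min_{t\in\mathrm{Lev}_n(T_* )}\log_n b_*(t)=\infty$, and let $\tilde{\mathbb{E}}=\tilde{\mathbb{E}}_{\mathbf{t}}$. Let $K\neq\emptyset$, $D$ an ultrafilter on $\mathcal{P}(K)$, and $\bar I=\langle I_k:k\in K\rangle$ a partition of a set $W$ into finite sets. Then for every $s\in T_*\setminus\{\langle\ \rangle\}$ there is a function $\lim^{D,\bar I}\colon(E'_s)^W\to\tilde{\mathbb{E}}$ such that $\lim^{D,\bar I}\bar r$ has stem $s$ for every $\bar r\in(E'_s)^W$, and such that the following holds: for any $i^*<\omega$, any $s_i\in T_*\setminus\{\langle\ \rangle\}$ and $\bar r^i=\langle r^i_\ell:\ell\in W\rangle\in(E'_{s_i})^W$ for $i<i^*$, any $a\in D$, and any $q\in\tilde{\mathbb{E}}$ with $q\le\lim^{D,\bar I}\bar r^i$ for all $i<i^*$, there are $q'\le q$ in $\tilde{\mathbb{E}}$ and $k\in a$ such that for every $i<i^*$, \[\frac{|\{\ell\in I_k: q'\le r^i_\ell\}|}{|I_k|}>1-\frac{1}{|s_i|}.\]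
   Context: A norm of subsets of a set $C$ is a map $\|\cdot\|\colon\mathcal{P}(C)\to[0,\infty]$ with $\|A\|\le\|B\|$ whenever $A\subseteq B\subseteq C$, and $\|\emptyset\|=0$. For an integer $m>1$, such a norm is $m$-co-big if for every finite set $I$, every sequence $\langle A_i: i\in I\rangle$ of subsets of $C$, every $g\colon I\to[0,1]$ with $\sum_{i\in I}g(i)=1$ and every real $\varepsilon>0$, the set $B=\{k\in C: \sum\{g(i): i\in I,\ k\in A_i\}>1-\varepsilon\}$ satisfies $\|B\|\ge \min_{i\in I}\|A_i\|-\log_m(1/\varepsilon)$. For a tree $T$ and $t\in T$, $\mathrm{suc}_T(t)$ is the set of immediate successors of $t$, and $\mathrm{Lev}_n(T)$ the set of nodes of height $n$. A tree-creature frame is a triple $\mathbf{t}=\langle T_*,b_*,\langle\|\cdot\|_t: t\in T_*\rangle\rangle$ where: $T_*\subseteq\omega^{<\omega}$ is a finitely branching tree (closed under initial segments) of height $\omega$ with single root $\langle\ \rangle$ and no maximal nodes; $b_*\colon T_*\to\omega$ satisfies $\lim_{n}\min_{t\in\mathrm{Lev}_n(T_* )}b_*(t)=\infty$; and for each $t$, $\|\cdot\|_t$ is a $b_*(t)$-co-big norm of subsets of $\mathrm{suc}_{T_*}(t)$ in which all singletons have norm $<1$ and $\|\mathrm{suc}_{T_*}(t)\|_t=\infty$. For a subtree $p\subseteq T_*$, $\mathrm{stem}(p)$ is the node $s\in p$ of least length with $|\mathrm{suc}_p(s)|\ge2$; $|s|$ is the length of $s$. $\tilde{\mathbb{E}}_{\mathbf{t}}$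 consists of all subtrees $p\subseteq T_*$ (nonempty, closed under initial segments) whose stem exists and with $\|p\|_t:=\|\mathrm{suc}_p(t)\|_t\ge 1+\frac{1}{|\mathrm{stem}(p)|}$ for every $t\in p$ extending $\mathrm{stem}(p)$ (convention $\frac10=\infty$), ordered by inclusion. For $s\in T_*\setminus\{\langle\ \rangle\}$, \[E'_s=\left\{p\in\tilde{\mathbb{E}}: \mathrm{stem}(p)=s\text{ and }\|p\|_t\ge 1+\tfrac{1}{|s|}+4\log_{b_*(t)}|t|\text{ for all }t\in p\text{ extending }s\right\}.\] *)

theory Defs
  imports "HOL-Library.Extended_Real" "HOL-Library.Sublist" "HOL-Library.FuncSet"
    "HOL-Library.Disjoint_Sets"
begin

definition subset_norm :: "'a set \<Rightarrow> ('a set \<Rightarrow> ereal) \<Rightarrow> bool" where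
  "subset_norm C nrm \<longleftrightarrow>
     (\<forall>A. A \<subseteq> C \<longrightarrow> 0 \<le> nrm A) \<and>
     (\<forall>A B. A \<subseteq> B \<and> B \<subseteq> C \<longrightarrow> nrm A \<le> nrm B) \<and>
     nrm {} = 0"

text \<open>Finite index sets are taken to be sets of natural numbers. Such a set is automatically
  nonempty here, because the weights sum to 1, so the minimum is well defined.\<close>

definition co_big :: "nat \<Rightarrow> 'a set \<Rightarrow> ('a set \<Rightarrow> ereal) \<Rightarrow> bool" where
  "co_big m C nrm \<longleftrightarrow>
     1 < m \<and> subset_norm C nrm \<and>
     (\<forall>(J :: nat set) A (g :: nat \<Rightarrow> real) (\<epsilon> :: real).
        finite J \<and> (\<forall>i\<in>J. A i \<subseteq> C) \<and> (\<forall>i\<in>J. g i \<in> {0..1}) \<and> (\<Sum>i\<in>J. g i) = 1 \<and> 0 < \<epsilon> \<longrightarrow>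
        nrm {x \<in> C. (\<Sum>i | i \<in> J \<and> x \<in> A i. g i) > 1 - \<epsilon>}
          \<ge> (MIN i\<in>J. nrm (A i)) - ereal (log (real m) (1 / \<epsilon>)))"

text \<open>Nodes of \<open>\<omega>\<^sup><\<^sup>\<omega>\<close> are lists of natural numbers, and the tree order is the prefix order.\<close>

type_synonym node = "nat list"

definition succs :: "node set \<Rightarrow> node \<Rightarrow> node set" where
  "succs T t = {u \<in> T. \<exists>n. u = t @ [n]}"

definition Lev :: "nat \<Rightarrow> node set \<Rightarrow> node set" where
  "Lev n T = {t \<in> T. length t = n}"

definition prefix_closed :: "node set \<Rightarrow> bool" where
  "prefix_closed T \<longleftrightarrow> (\<forall>t\<in>T. \<forall>u. prefix u t \<longrightarrow> u \<in> T)"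

locale tree_creature_frame =
  fixes T :: "node set" and b :: "node \<Rightarrow> nat" and nrm :: "node \<Rightarrow> node set \<Rightarrow> ereal"
  assumes root: "[] \<in> T"
    and closed: "prefix_closed T"
    and finitely_branching: "\<And>t. t \<in> T \<Longrightarrow> finite (succs T t)"
    and height: "\<And>n. Lev n T \<noteq> {}"
    and no_maximal: "\<And>t. t \<in> T \<Longrightarrow> succs T t \<noteq> {}"
    and b_lim: "filterlim (\<lambda>n. MIN t\<in>Lev n T. b t) at_top sequentially"
    and co_big: "\<And>t. t \<in> T \<Longrightarrow> co_big (b t) (succs T t) (nrm t)"
    and singleton: "\<And>t u. t \<in> T \<Longrightarrow> u \<in> succs T t \<Longrightarrow> nrm t {u} < 1"
    and full: "\<And>t. t \<in> T \<Longrightarrow> nrm t (succs T t) = \<infinity>"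

definition splitting :: "node set \<Rightarrow> node \<Rightarrow> bool" where
  "splitting p t \<longleftrightarrow> t \<in> p \<and> card (succs p t) \<ge> 2"

text \<open>For a prefix-closed, finitely branching \<open>p\<close> with a splitting node, the splitting node of least
  length is unique, since below the first splitting level each level has at most one node. So the
  choice made by \<open>arg_min\<close> is immaterial.\<close>

definition stem :: "node set \<Rightarrow> node" where
  "stem p = arg_min length (splitting p)"

text \<open>In \<open>ereal\<close> one has \<open>1 / 0 = \<infinity>\<close>, which is the convention wanted when the stem is the root.
  The forcing order is inclusion \<open>\<subseteq>\<close>.\<close>

definition EE :: "node set \<Rightarrow> (node \<Rightarrow> node set \<Rightarrow> ereal) \<Rightarrow> node set set" where
  "EE T nrm = {p. p \<subseteq> T \<and> p \<noteq> {} \<and> prefix_closed p \<and> (\<exists>t. splitting p t) \<and>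
     (\<forall>t\<in>p. prefix (stem p) t \<longrightarrow>
        nrm t (succs p t) \<ge> 1 + 1 / ereal (real (length (stem p))))}"

definition EE' :: "node set \<Rightarrow> (node \<Rightarrow> nat) \<Rightarrow> (node \<Rightarrow> node set \<Rightarrow> ereal) \<Rightarrow> node \<Rightarrow> node set set" where
  "EE' T b nrm s = {p \<in> EE T nrm. stem p = s \<and>
     (\<forall>t\<in>p. prefix s t \<longrightarrow>
        nrm t (succs p t) \<ge>
          1 + 1 / ereal (real (length s)) + ereal (4 * log (real (b t)) (real (length t))))}"

definition ultrafilter_on :: "'k set \<Rightarrow> 'k set set \<Rightarrow> bool" where
  "ultrafilter_on K D \<longleftrightarrow>
     D \<subseteq> Pow K \<and> K \<in> D \<and> {} \<notin> D \<and>
     (\<forall>A\<in>D. \<forall>B\<in>D. A \<inter> B \<in> D) \<and>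
     (\<forall>A\<in>D. \<forall>B. A \<subseteq> B \<and> B \<subseteq> K \<longrightarrow> B \<in> D) \<and>
     (\<forall>A. A \<subseteq> K \<longrightarrow> A \<in> D \<or> K - A \<in> D)"

text \<open>As usual for partitions, the parts are nonempty.\<close>

definition finite_partition :: "'k set \<Rightarrow> 'w set \<Rightarrow> ('k \<Rightarrow> 'w set) \<Rightarrow> bool" where
  "finite_partition K W I \<longleftrightarrow>
     disjoint_family_on I K \<and> (\<Union>k\<in>K. I k) = W \<and> (\<forall>k\<in>K. finite (I k) \<and> I k \<noteq> {})"

end

theory Submission imports Defs begin

text \<open>
  Call a node \<open>t\<close> well shared at \<open>k\<close> if slightly more than the required fraction of the trees
  \<open>r l\<close>, \<open>l \<in> I k\<close>, contain it. By co-bigness the well-shared successors of a well-shared node form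
  a set of large norm, and the limit tree consists of the nodes that are well shared at \<open>D\<close>-many
  \<open>k\<close> all along their branch above \<open>s\<close>. Given \<open>q\<close> below finitely many limits, climb in \<open>q\<close>
  to a long node \<open>v\<close> and fix some \<open>k \<in> a\<close> at which \<open>v\<close> is well shared for all the sequences. Only
  now is the finite set \<open>I k\<close> known; climb further through well-shared nodes of \<open>q\<close> to a node \<open>w\<close>
  so long that above it the logarithm to base \<open>b t\<close> of the number of trees involved is negligible.
  Then \<open>q\<close> and all the trees \<open>r i l\<close> containing \<open>w\<close> can simply be intersected above \<open>w\<close>.
\<close>

section \<open>Co-bigness with equal weights\<close>

text \<open>Equal weights \<open>1 / card J\<close> turn the weighted sum into a count. Co-bigness
  speaks of index sets of naturals only, so \<open>J\<close> is enumerated first; \<open>c\<close>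
  stands in for the minimum of the norms.\<close>

lemma co_big_uniform:
  fixes A :: "'i \<Rightarrow> 'a set" and \<epsilon> :: real
  assumes big: "co_big m C nrm" and fin: "finite J" and ne: "J \<noteq> {}"
    and sub: "\<And>i. i \<in> J \<Longrightarrow> A i \<subseteq> C" and c: "\<And>i. i \<in> J \<Longrightarrow> c \<le> nrm (A i)"
    and \<epsilon>: "0 < \<epsilon>"
  shows "c - ereal (log (real m) (1 / \<epsilon>))
           \<le> nrm {x \<in> C. (1 - \<epsilon>) * real (card J) < real (card {i \<in> J. x \<in> A i})}"
proof -
  define n where "n = card J"
  have n: "0 < n"
    using fin ne by (simp add: n_def card_gt_0_iff)
  obtain h where h: "bij_betw h {0..<n} J"
    using ex_bij_betw_nat_finite[OF fin] n_def by blast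
  have hJ: "h i \<in> J" if "i < n" for i
    using h that by (auto simp: bij_betw_def)
  have count: "card {i. i \<in> {0..<n} \<and> x \<in> A (h i)} = card {i \<in> J. x \<in> A i}" for x
  proof (rule bij_betw_same_card[of h])
    show "bij_betw h {i. i \<in> {0..<n} \<and> x \<in> A (h i)} {i \<in> J. x \<in> A i}"
      using h unfolding bij_betw_def inj_on_def by auto
  qed
  have gn: "(\<Sum>i | i \<in> {0..<n} \<and> x \<in> A (h i). 1 / real n) = real (card {i \<in> J. x \<in> A i}) / real n" for x
    by (subst count[symmetric]) simp
  have "(MIN i\<in>{0..<n}. nrm (A (h i))) - ereal (log (real m) (1 / \<epsilon>))
      \<le> nrm {x \<in> C. (\<Sum>i | i \<in> {0..<n} \<and> x \<in> A (h i). 1 / real n) > 1 - \<epsilon>}"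
    using big[unfolded co_big_def, THEN conjunct2, THEN conjunct2, rule_format,
        of "{0..<n}" "\<lambda>i. A (h i)" "\<lambda>_. 1 / real n" \<epsilon>] n \<epsilon> sub hJ by auto
  also have "{x \<in> C. (\<Sum>i | i \<in> {0..<n} \<and> x \<in> A (h i). 1 / real n) > 1 - \<epsilon>}
      = {x \<in> C. (1 - \<epsilon>) * real (card J) < real (card {i \<in> J. x \<in> A i})}"
    unfolding gn using n by (simp add: n_def pos_less_divide_eq)
  finally have le: "(MIN i\<in>{0..<n}. nrm (A (h i))) - ereal (log (real m) (1 / \<epsilon>))
      \<le> nrm {x \<in> C. (1 - \<epsilon>) * real (card J) < real (card {i \<in> J. x \<in> A i})}" .
  have "c \<le> (MIN i\<in>{0..<n}. nrm (A (h i)))"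
    using n hJ c by (intro Min.boundedI) auto
  then show ?thesis
    by (intro order_trans[OF _ le] ereal_minus_mono) auto
qed

text \<open>For \<open>\<epsilon> = 1 / card J\<close>, a point must lie in more than
  \<open>card J - 1\<close> of the sets, that is, in all of them. So an intersection costs only the
  logarithm of the number of sets.\<close>

lemma co_big_Inter:
  fixes A :: "'i \<Rightarrow> 'a set"
  assumes big: "co_big m C nrm" and fin: "finite J" and ne: "J \<noteq> {}"
    and sub: "\<And>i. i \<in> J \<Longrightarrow> A i \<subseteq> C" and c: "\<And>i. i \<in> J \<Longrightarrow> c \<le> nrm (A i)"
  shows "c - ereal (log (real m) (real (card J))) \<le> nrm (\<Inter>i\<in>J. A i)"
proof -
  have pos: "0 < card J"
    using fin ne by (simp add: card_gt_0_iff)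
  have "(1 - 1 / real (card J)) * real (card J) < real (card {i \<in> J. x \<in> A i}) \<longleftrightarrow> (\<forall>i\<in>J. x \<in> A i)" for x
  proof -
    have "(1 - 1 / real (card J)) * real (card J) = real (card J) - 1"
      using pos by (simp add: field_simps)
    then have "(1 - 1 / real (card J)) * real (card J) < real (card {i \<in> J. x \<in> A i})
        \<longleftrightarrow> card J \<le> card {i \<in> J. x \<in> A i}"
      by linarith
    also have "\<dots> \<longleftrightarrow> {i \<in> J. x \<in> A i} = J"
      using fin card_seteq[of J "{i \<in> J. x \<in> A i}"] by auto
    finally show ?thesis
      by blast
  qed
  then have "{x \<in> C. (1 - 1 / real (card J)) * real (card J) < real (card {i \<in> J. x \<in> A i})} = (\<Inter>i\<in>J. A i)"
    using sub ne by blast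
  then show ?thesis
    using co_big_uniform[OF big fin ne, where A = A and c = c and \<epsilon> = "1 / real (card J)"] sub c pos by simp
qed

section \<open>Stems, splitting nodes and climbing in a tree\<close>

lemma one_plus_inverse_ereal:
  "0 < n \<Longrightarrow> 1 + 1 / ereal (real n) = ereal (1 + 1 / real n)"
  by (simp add: one_ereal_def)

lemma succs_mono: "p \<subseteq> q \<Longrightarrow> succs p t \<subseteq> succs q t"
  by (auto simp: succs_def)

text \<open>The node picked by \<open>arg_min\<close> extends \<open>s\<close> but is no longer than
  \<open>s\<close>.\<close>

lemma stem_eqI:
  assumes "splitting p s" and "\<And>t. splitting p t \<Longrightarrow> prefix s t"
  shows "stem p = s"
proof -
  have "splitting p (stem p)" and min: "length (stem p) \<le> length s"
    unfolding stem_def using arg_min_nat_lemma[of "splitting p" s length] assms(1) by auto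
  then have "prefix s (stem p)"
    using assms(2) by blast
  then show ?thesis
    using min by (auto simp: prefix_def)
qed

text \<open>A node strictly below \<open>v\<close> can have no successor other than the next initial
  segment of \<open>v\<close>, so it does not split.\<close>

lemma splitting_comparable:
  assumes "splitting p t" and "\<And>u. u \<in> p \<Longrightarrow> prefix u v \<or> prefix v u"
  shows "prefix v t"
proof (rule ccontr)
  assume no: "\<not> prefix v t"
  then have tv: "strict_prefix t v"
    using assms by (auto simp: splitting_def strict_prefix_def)
  have "succs p t \<subseteq> {take (Suc (length t)) v}"
  proof
    fix u
    assume "u \<in> succs p t"
    then have len: "length u = Suc (length t)" and "prefix u v \<or> prefix v u"
      using assms(2) by (auto simp: succs_def)
    moreover have le: "length u \<le> length v"
      using len tv by (simp add: Suc_leI prefix_length_less)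
    ultimately have "prefix u v"
      by (metis prefix_def append_eq_append_conv le_antisym prefix_length_le append_Nil2 prefix_order.refl)
    then show "u \<in> {take (Suc (length t)) v}"
      using len by (auto simp: prefix_def)
  qed
  then have "card (succs p t) \<le> 1"
    using card_mono[of "{take (Suc (length t)) v}" "succs p t"] by simp
  then show False
    using assms(1) by (simp add: splitting_def)
qed

lemma splitting_stem: "p \<in> EE T nrm \<Longrightarrow> splitting p (stem p)"
  unfolding stem_def by (auto simp: EE_def intro: arg_min_natI)

lemma stem_mem: "p \<in> EE T nrm \<Longrightarrow> stem p \<in> p"
  using splitting_stem unfolding splitting_def by blast

lemma EE_subset: "p \<in> EE T nrm \<Longrightarrow> p \<subseteq> T"
  by (simp add: EE_def)

lemma EE_norm:
  "p \<in> EE T nrm \<Longrightarrow> t \<in> p \<Longrightarrow> prefix (stem p) t \<Longrightarrow>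
     1 + 1 / ereal (real (length (stem p))) \<le> nrm t (succs p t)"
  by (simp add: EE_def)

text \<open>\<open>P\<close> collects whatever a climb must preserve. Each step appends one entry,
  so every length from that of \<open>v\<close> on is attained exactly.\<close>

lemma extend_to_length:
  assumes "P v" and "\<And>t. P t \<Longrightarrow> length v \<le> length t \<Longrightarrow> \<exists>n. P (t @ [n])" and "length v \<le> M"
  shows "\<exists>w. P w \<and> length w = M"
  using assms(3)
proof (induction M rule: dec_induct)
  case base
  then show ?case
    using assms(1) by blast
next
  case (step M)
  then obtain w where "P w" "length w = M"
    by blast
  then show ?case
    using assms(2)[of w] step(1) by fastforce
qed

section \<open>Finitely many decisions of an ultrafilter\<close>

text \<open>The factor \<open>K\<close> covers empty \<open>J\<close>, where the intersection is the
  whole type.\<close>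

lemma ultrafilter_on_Inter:
  assumes "ultrafilter_on K D" and "finite J" and "\<And>i. i \<in> J \<Longrightarrow> X i \<in> D"
  shows "K \<inter> (\<Inter>i\<in>J. X i) \<in> D"
  using assms(2,3)
proof (induction J rule: finite_induct)
  case empty
  then show ?case
    using assms(1) by (simp add: ultrafilter_on_def)
next
  case (insert j J)
  then have "X j \<inter> (K \<inter> (\<Inter>i\<in>J. X i)) \<in> D"
    using assms(1) by (simp add: ultrafilter_on_def)
  then show ?case
    by (simp add: Int_ac)
qed

text \<open>For each \<open>u\<close> in the finite set \<open>C\<close>, either the set of
  \<open>k\<close> with \<open>P k u\<close> or its complement is in \<open>D\<close>. Any
  \<open>k\<close> common to \<open>G\<close> and all these chosen sets decides every
  \<open>u\<close> as \<open>D\<close> does.\<close>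

lemma ultrafilter_on_limit_set:
  assumes D: "ultrafilter_on K D" and "G \<in> D" and "finite C"
  obtains k where "k \<in> G" "{u \<in> C. {k \<in> K. P k u} \<in> D} = {u \<in> C. P k u}"
proof -
  define X where "X u = (if {k \<in> K. P k u} \<in> D then {k \<in> K. P k u} else K - {k \<in> K. P k u})" for u
  have "X u \<in> D" for u
  proof -
    have "\<forall>A. A \<subseteq> K \<longrightarrow> A \<in> D \<or> K - A \<in> D"
      using D by (simp add: ultrafilter_on_def)
    from this[rule_format, of "{k \<in> K. P k u}"] show ?thesis
      by (auto simp: X_def)
  qed
  then have "K \<inter> (\<Inter>u\<in>C. X u) \<in> D"
    using ultrafilter_on_Inter[OF D \<open>finite C\<close>] by blast
  then have "G \<inter> (K \<inter> (\<Inter>u\<in>C. X u)) \<in> D"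
    using D \<open>G \<in> D\<close> unfolding ultrafilter_on_def by blast
  then have "G \<inter> (K \<inter> (\<Inter>u\<in>C. X u)) \<noteq> {}"
    using D unfolding ultrafilter_on_def by metis
  then obtain k where k: "k \<in> G" "k \<in> K" "\<forall>u\<in>C. k \<in> X u"
    by blast
  have "{k \<in> K. P k u} \<in> D \<longleftrightarrow> P k u" if "u \<in> C" for u
    using k(2) k(3)[rule_format, OF that] by (auto simp: X_def split: if_splits)
  then show ?thesis
    using that[OF k(1)] by blast
qed

section \<open>The sharing threshold\<close>

text \<open>With \<open>threshold s n = (1 - 1/s) (1 + 1/n)\<close> the ratio of consecutive values is
  \<open>1 - 1/(n + 1)\<^sup>2\<close>; for \<open>n \<ge> 2\<close> a loss by a factor \<open>1 - 1/n\<^sup>4\<close>, which costs exactly the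
  reserve \<open>4 log n\<close> in the definition of \<open>EE'\<close>, is therefore affordable. For \<open>s = 1\<close> everything
  degenerates to \<open>0\<close>, so that only positivity is maintained.\<close>

definition threshold :: "nat \<Rightarrow> nat \<Rightarrow> real" where
  "threshold s n = (1 - 1 / real s) * (1 + 1 / real n)"

text \<open>This makes \<open>s\<close> itself well shared, as it lies in all the trees and so has
  share 1.\<close>

lemma threshold_start: "0 < s \<Longrightarrow> threshold s s < 1"
  by (simp add: threshold_def field_simps)

text \<open>However long a climb is, a well-shared node still has more than the fraction finally
  claimed.\<close>

lemma threshold_ge: "0 < s \<Longrightarrow> 1 - 1 / real s \<le> threshold s n"
  by (simp add: threshold_def mult_le_cancel_left1)

lemma threshold_step:
  assumes "0 < s" and "s \<le> n"
  shows "threshold s (Suc n) \<le> threshold s n * (1 - 1 / real n ^ 4)"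
proof (cases "s = 1")
  case True
  then show ?thesis
    by (simp add: threshold_def)
next
  case False
  then have n: "2 \<le> real n"
    using assms by linarith
  \<comment> \<open>This needs \<open>n \<ge> 2\<close>; squaring compares \<open>(n + 1)^2\<close>
    with \<open>n^4\<close>.\<close>
  have "real n + 1 \<le> real n ^ 2"
    using n mult_right_mono[OF n, of "real n"] unfolding power2_eq_square by linarith
  then have "(real n + 1) ^ 2 \<le> (real n ^ 2) ^ 2"
    using n by (intro power_mono) auto
  then have "1 / real n ^ 4 \<le> 1 / (real n + 1) ^ 2"
    using n by (intro divide_left_mono) auto
  then have "(1 + 1 / real n) * (1 - 1 / (real n + 1) ^ 2) \<le> (1 + 1 / real n) * (1 - 1 / real n ^ 4)"
    using n by (intro mult_left_mono) auto
  moreover have "1 + 1 / (real n + 1) = (1 + 1 / real n) * (1 - 1 / (real n + 1) ^ 2)"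
    using n by (simp add: divide_simps) (simp add: power2_eq_square algebra_simps)
  ultimately have "1 + 1 / (real n + 1) \<le> (1 + 1 / real n) * (1 - 1 / real n ^ 4)"
    by linarith
  then have "(1 - 1 / real s) * (1 + 1 / (real n + 1))
      \<le> (1 - 1 / real s) * ((1 + 1 / real n) * (1 - 1 / real n ^ 4))"
    using assms by (intro mult_left_mono) auto
  then show ?thesis
    by (simp add: threshold_def mult.assoc add.commute)
qed

section \<open>Well-shared nodes and the limit tree\<close>

definition share :: "'w set \<Rightarrow> ('w \<Rightarrow> node set) \<Rightarrow> node \<Rightarrow> real" where
  "share F r t = real (card {l \<in> F. t \<in> r l}) / real (card F)"

definition well_shared :: "node \<Rightarrow> 'w set \<Rightarrow> ('w \<Rightarrow> node set) \<Rightarrow> node \<Rightarrow> bool" where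
  "well_shared s F r t \<longleftrightarrow> threshold (length s) (length t) < share F r t"

text \<open>A longer node faces a threshold that is no higher, so being well shared need not pass to
  initial segments. Demanding it of every \<open>u\<close> between \<open>s\<close> and
  \<open>t\<close> makes the set prefix closed.\<close>

definition lim_tree ::
    "node set \<Rightarrow> 'k set \<Rightarrow> 'k set set \<Rightarrow> ('k \<Rightarrow> 'w set) \<Rightarrow> node \<Rightarrow> ('w \<Rightarrow> node set) \<Rightarrow> node set" where
  "lim_tree T K D I s r = {t \<in> T. strict_prefix t s \<or>
     prefix s t \<and> (\<forall>u. prefix s u \<and> prefix u t \<longrightarrow> {k \<in> K. well_shared s (I k) r u} \<in> D)}"

section \<open>Norms, splitting and levels in a frame\<close>

context tree_creature_frame
begin

lemma finite_succs: "p \<subseteq> T \<Longrightarrow> t \<in> T \<Longrightarrow> finite (succs p t)"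
  using finite_subset[OF succs_mono] finitely_branching by blast

lemma norm_mono: "t \<in> T \<Longrightarrow> A \<subseteq> B \<Longrightarrow> B \<subseteq> succs T t \<Longrightarrow> nrm t A \<le> nrm t B"
  using co_big[of t] unfolding co_big_def subset_norm_def by blast

lemma norm_empty: "t \<in> T \<Longrightarrow> nrm t {} = 0"
  using co_big[of t] unfolding co_big_def subset_norm_def by blast

text \<open>Norm at least 1 rules out both the empty set, of norm 0, and singletons, of norm below
  1.\<close>

lemma splittingI:
  assumes "p \<subseteq> T" "t \<in> p" "1 \<le> nrm t (succs p t)"
  shows "splitting p t"
proof (rule ccontr)
  assume "\<not> splitting p t"
  then have "card (succs p t) = 0 \<or> card (succs p t) = 1"
    using assms(2) by (auto simp: splitting_def)
  then consider "succs p t = {}" | u where "succs p t = {u}"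
    using assms finite_succs[of p t] by (auto simp: card_1_singleton_iff)
  then show False
  proof cases
    case 1
    then show False
      using assms norm_empty[of t] by auto
  next
    case (2 u)
    then have "u \<in> succs T t"
      using succs_mono[OF assms(1), of t] by blast
    then show False
      using singleton[of t u] 2 assms by (auto simp: leD)
  qed
qed

lemma splitting_mono: "q \<subseteq> p \<Longrightarrow> p \<subseteq> T \<Longrightarrow> splitting q t \<Longrightarrow> splitting p t"
  unfolding splitting_def
  by (meson card_mono finite_succs order_trans subset_iff succs_mono)

text \<open>The norm bound at \<open>s\<close> forces \<open>s\<close> to split, and
  \<open>split\<close> then makes it the stem. As \<open>s\<close> is not the root, the bound is a
  real number.\<close>

lemma EE_I:
  assumes "p \<subseteq> T" "prefix_closed p" "s \<in> p" "0 < length s"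
    and norm: "\<And>t. t \<in> p \<Longrightarrow> prefix s t \<Longrightarrow> ereal (1 + 1 / real (length s)) \<le> nrm t (succs p t)"
    and split: "\<And>t. splitting p t \<Longrightarrow> prefix s t"
  shows "p \<in> EE T nrm" "stem p = s"
proof -
  have "1 \<le> ereal (1 + 1 / real (length s))"
    by (simp add: one_ereal_def)
  also have "\<dots> \<le> nrm s (succs p s)"
    using norm[OF assms(3)] by simp
  finally have "splitting p s"
    by (rule splittingI[OF assms(1,3)])
  then show "stem p = s"
    using split by (rule stem_eqI)
  then show "p \<in> EE T nrm"
    using assms \<open>splitting p s\<close> one_plus_inverse_ereal[of "length s"] by (auto simp: EE_def)
qed

text \<open>Finiteness makes \<open>MIN\<close> over a level a true lower bound for \<open>b\<close>
  at each of its nodes.\<close>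

lemma finite_Lev: "finite (Lev n T)"
proof (induction n)
  case 0
  then show ?case
    by (rule finite_subset[of _ "{[]}"]) (auto simp: Lev_def)
next
  case (Suc n)
  have "Lev (Suc n) T \<subseteq> (\<Union>t\<in>Lev n T. succs T t)"
  proof
    fix u
    assume u: "u \<in> Lev (Suc n) T"
    then have "u \<noteq> []"
      by (auto simp: Lev_def)
    then have eq: "u = butlast u @ [last u]"
      by simp
    then have "prefix (butlast u) u"
      by (metis prefixI)
    then have "butlast u \<in> Lev n T"
      using u closed by (auto simp: Lev_def prefix_closed_def)
    moreover have "u \<in> succs T (butlast u)"
      using u eq by (auto simp: Lev_def succs_def)
    ultimately show "u \<in> (\<Union>t\<in>Lev n T. succs T t)"
      by blast
  qed
  then show ?case
    using Suc finitely_branching by (auto intro: finite_subset simp: Lev_def)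
qed

text \<open>Far enough up, intersecting a fixed number \<open>c\<close> of trees becomes as cheap as
  desired, because \<open>b\<close> eventually exceeds
  \<open>(c + 1) powr (1 / \<delta>)\<close>.\<close>

lemma log_b_small:
  assumes "0 < \<delta>"
  obtains N where "\<And>t. t \<in> T \<Longrightarrow> N \<le> length t \<Longrightarrow> log (real (b t)) (real c) \<le> \<delta>"
proof -
  obtain Z :: nat where Z: "max 2 ((real c + 1) powr (1 / \<delta>)) \<le> real Z"
    using real_arch_simple by blast
  obtain N where N: "\<And>n. N \<le> n \<Longrightarrow> Z \<le> (MIN t\<in>Lev n T. b t)"
    using b_lim unfolding filterlim_at_top eventually_sequentially by blast
  have "log (real (b t)) (real c) \<le> \<delta>" if "t \<in> T" "N \<le> length t" for t
  proof -
    have "Z \<le> b t"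
      using N[OF that(2)] finite_Lev[of "length t"] height[of "length t"] that(1)
      by (simp add: Lev_def)
    then have bt: "2 \<le> real (b t)" "(real c + 1) powr (1 / \<delta>) \<le> real (b t)"
      using Z by auto
    show ?thesis
    proof (cases "c = 0")
      \<comment> \<open>Here \<open>ln 0 = 0\<close> by convention, so the logarithm is 0.\<close>
      case True
      then show ?thesis
        using assms by (simp add: log_def)
    next
      case False
      have "real c \<le> ((real c + 1) powr (1 / \<delta>)) powr \<delta>"
        using assms by (simp add: powr_powr)
      also have "\<dots> \<le> real (b t) powr \<delta>"
        using bt assms by (intro powr_mono2) auto
      finally show ?thesis
        using bt False by (simp add: log_le_iff)
    qed
  qed
  then show ?thesis
    using that by blast
qed

lemma EE'_D:
  assumes "p \<in> EE' T b nrm s" "0 < length s"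
  shows "p \<in> EE T nrm" "stem p = s" "s \<in> p"
    "\<And>t. t \<in> p \<Longrightarrow> prefix s t \<Longrightarrow>
       ereal (1 + 1 / real (length s) + 4 * log (real (b t)) (real (length t))) \<le> nrm t (succs p t)"
  using assms stem_mem one_plus_inverse_ereal[of "length s"] unfolding EE'_def by auto

lemma EE'_norm:
  assumes "p \<in> EE' T b nrm s" "0 < length s" "t \<in> p" "prefix s t"
  shows "ereal (1 + 1 / real (length s)) \<le> nrm t (succs p t)"
  using EE_norm[of p T nrm t] EE'_D[OF assms(1,2)] assms(2-) one_plus_inverse_ereal[of "length s"]
  by simp

section \<open>The limit tree is a condition with stem \<open>s\<close>\<close>

text \<open>Co-bigness is applied only to the trees that already contain \<open>t\<close>. A
  successor in more than the fraction \<open>1 - 1 / n ^ 4\<close> of them stays above the threshold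
  for length \<open>n + 1\<close>, and the reserve in \<open>EE'\<close> pays for this loss.\<close>

lemma well_shared_step:
  assumes F: "finite F" "F \<noteq> {}" and r: "\<And>l. l \<in> F \<Longrightarrow> r l \<in> EE' T b nrm s"
    and s: "0 < length s" and t: "t \<in> T" "prefix s t" and shared: "well_shared s F r t"
  shows "ereal (1 + 1 / real (length s)) \<le> nrm t {u \<in> succs T t. well_shared s F r u}"
proof -
  define n where "n = length t"
  define X where "X = {l \<in> F. t \<in> r l}"
  define A where "A l = succs (r l) t" for l
  have n: "0 < n" "length s \<le> n"
    using s t(2) by (auto simp: n_def dest: prefix_length_le)
  have cF: "0 < real (card F)"
    using F by (simp add: card_gt_0_iff)
  have X: "threshold (length s) n * card F < card X"
    using shared cF by (simp add: well_shared_def share_def X_def n_def pos_less_divide_eq)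
  \<comment> \<open>Together with the strict bound on \<open>card X\<close>, this makes
    \<open>X\<close> nonempty, even for \<open>length s = 1\<close>, where the threshold is
    0.\<close>
  have th: "0 \<le> threshold (length s) n"
    using threshold_ge[OF s, of n] s
    by (smt (verit, best) divide_le_eq_1 Suc_leI of_nat_1 of_nat_le_iff One_nat_def)
  have "0 < card X"
    using X th cF by (smt (verit) mult_nonneg_nonneg of_nat_0_less_iff)
  then have finX: "finite X" and neX: "X \<noteq> {}"
    by (auto simp: card_gt_0_iff)
  have A: "A l \<subseteq> succs T t"
    "ereal (1 + 1 / real (length s) + 4 * log (real (b t)) (real n)) \<le> nrm t (A l)" if "l \<in> X" for l
    using that EE'_D[OF r s, of l] t(2) succs_mono[OF EE_subset, of "r l" T nrm t]
    by (auto simp: X_def A_def n_def)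
  have "ereal (1 + 1 / real (length s) + 4 * log (real (b t)) (real n))
      - ereal (log (real (b t)) (1 / (1 / real n ^ 4)))
      \<le> nrm t {u \<in> succs T t. (1 - 1 / real n ^ 4) * card X < card {l \<in> X. u \<in> A l}}"
    using n by (intro co_big_uniform[OF co_big[OF t(1)] finX neX A]) auto
  also have "\<dots> \<le> nrm t {u \<in> succs T t. well_shared s F r u}"
  proof (intro norm_mono[OF t(1)] subsetI)
    fix u
    assume "u \<in> {u \<in> succs T t. (1 - 1 / real n ^ 4) * card X < card {l \<in> X. u \<in> A l}}"
    then have u: "u \<in> succs T t" and lt: "(1 - 1 / real n ^ 4) * card X < card {l \<in> X. u \<in> A l}"
      by auto
    have "0 \<le> 1 - 1 / real n ^ 4"
      using n by (simp add: one_le_power)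
    then have "(1 - 1 / real n ^ 4) * (threshold (length s) n * card F) \<le> (1 - 1 / real n ^ 4) * card X"
      using X by (intro mult_left_mono) auto
    moreover have "threshold (length s) (Suc n) * card F
        \<le> threshold (length s) n * (1 - 1 / real n ^ 4) * card F"
      using threshold_step[OF s n(2)] by (intro mult_right_mono) auto
    moreover have "card {l \<in> X. u \<in> A l} \<le> card {l \<in> F. u \<in> r l}"
      using F(1) by (intro card_mono) (auto simp: X_def A_def succs_def)
    ultimately have "threshold (length s) (Suc n) * card F < card {l \<in> F. u \<in> r l}"
      using lt by (simp add: algebra_simps)
    moreover have "length u = Suc n"
      using u by (auto simp: succs_def n_def)
    ultimately show "u \<in> {u \<in> succs T t. well_shared s F r u}"
      using u cF by (simp add: well_shared_def share_def pos_less_divide_eq)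
  qed auto
  finally show ?thesis
    using n by (simp add: log_nat_power)
qed

lemma lim_tree_subset: "lim_tree T K D I s r \<subseteq> T"
  by (auto simp: lim_tree_def)

lemma prefix_closed_lim_tree: "prefix_closed (lim_tree T K D I s r)"
  unfolding prefix_closed_def
proof (intro ballI allI impI)
  fix t u
  assume t: "t \<in> lim_tree T K D I s r" and u: "prefix u t"
  have "u \<in> T"
    using t u closed by (auto simp: lim_tree_def prefix_closed_def)
  moreover have "prefix u s \<or> prefix s u" if "prefix s t"
    using prefix_same_cases[OF u that] .
  ultimately show "u \<in> lim_tree T K D I s r"
    using t u by (auto simp: lim_tree_def intro: prefix_order.trans)
qed

lemma splitting_lim_tree:
  assumes "splitting (lim_tree T K D I s r) t"
  shows "prefix s t"
  using assms by (rule splitting_comparable) (auto simp: lim_tree_def)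

lemma lim_treeD:
  assumes "t \<in> lim_tree T K D I s r" "prefix s t" "prefix s u" "prefix u t"
  shows "{k \<in> K. well_shared s (I k) r u} \<in> D"
  using assms by (auto simp: lim_tree_def)

text \<open>At a node \<open>t\<close> of the limit, one \<open>k\<close> at which \<open>t\<close>
  is well shared decides all the finitely many successors as \<open>D\<close> does. The norm
  estimate for that \<open>k\<close> thus carries over to the limit.\<close>

lemma lim_tree_EE:
  assumes D: "ultrafilter_on K D"
    and I: "\<And>k. k \<in> K \<Longrightarrow> finite (I k) \<and> I k \<noteq> {}"
    and r: "\<And>k l. k \<in> K \<Longrightarrow> l \<in> I k \<Longrightarrow> r l \<in> EE' T b nrm s"
    and s: "s \<in> T" "s \<noteq> []"
  shows "lim_tree T K D I s r \<in> EE T nrm" "stem (lim_tree T K D I s r) = s"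
proof -
  let ?L = "lim_tree T K D I s r"
  have len: "0 < length s"
    using s(2) by simp
  have norm: "ereal (1 + 1 / real (length s)) \<le> nrm t (succs ?L t)" if t: "t \<in> ?L" "prefix s t" for t
  proof -
    have tT: "t \<in> T"
      using t by (simp add: lim_tree_def)
    obtain k where k: "k \<in> {k \<in> K. well_shared s (I k) r t}"
      and eq: "{u \<in> succs T t. {k \<in> K. well_shared s (I k) r u} \<in> D}
        = {u \<in> succs T t. well_shared s (I k) r u}"
      using ultrafilter_on_limit_set[OF D, where G = "{k \<in> K. well_shared s (I k) r t}"
          and C = "succs T t" and P = "\<lambda>k. well_shared s (I k) r"]
        lim_treeD[OF t t(2)] finitely_branching[OF tT] by auto
    \<comment> \<open>The rest of the branch below \<open>u\<close> already satisfies the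
      requirement because \<open>t\<close> is in the limit; only \<open>u\<close> itself is to be
      tested.\<close>
    have "succs ?L t = {u \<in> succs T t. {k \<in> K. well_shared s (I k) r u} \<in> D}"
    proof (intro set_eqI iffI)
      fix u
      assume u: "u \<in> succs ?L t"
      then have "u \<in> ?L" "prefix s u"
        using t(2) by (auto simp: succs_def)
      moreover have "u \<in> succs T t"
        using u succs_mono[OF lim_tree_subset] by blast
      ultimately show "u \<in> {u \<in> succs T t. {k \<in> K. well_shared s (I k) r u} \<in> D}"
        using lim_treeD[of u] by blast
    next
      fix u
      assume "u \<in> {u \<in> succs T t. {k \<in> K. well_shared s (I k) r u} \<in> D}"
      then show "u \<in> succs ?L t"
        using t lim_treeD[OF t] by (auto simp: succs_def lim_tree_def)
    qed
    then show ?thesis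
      using well_shared_step[of "I k" r s t] I r k len tT t(2) eq by auto
  qed
  have "well_shared s (I k) r s" if "k \<in> K" for k
  proof -
    have "{l \<in> I k. s \<in> r l} = I k"
      using EE'_D(3)[OF r len] that by blast
    then show ?thesis
      using I[OF that] threshold_start[OF len] by (simp add: well_shared_def share_def)
  qed
  then have "{k \<in> K. well_shared s (I k) r s} = K"
    by blast
  then have "{k \<in> K. well_shared s (I k) r s} \<in> D"
    using D by (simp add: ultrafilter_on_def)
  then have sL: "s \<in> ?L"
    using s by (auto simp: lim_tree_def dest: prefix_order.antisym)
  show "?L \<in> EE T nrm"
    by (rule EE_I(1)[OF lim_tree_subset prefix_closed_lim_tree sL len]) (fact norm splitting_lim_tree)+
  show "stem ?L = s"
    by (rule EE_I(2)[OF lim_tree_subset prefix_closed_lim_tree sL len]) (fact norm splitting_lim_tree)+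
qed

section \<open>Intersecting conditions above a common node\<close>

text \<open>Keeping only nodes comparable with \<open>v\<close> makes \<open>v\<close> the new stem,
  which lowers the required norm to \<open>1 + 1 / length v\<close>. The gap up to \<open>c\<close>
  pays for the intersection.\<close>

lemma EE_Inter_above:
  assumes q: "q \<in> EE T nrm" and v: "v \<in> q" "prefix (stem q) v" "0 < length v"
    and R: "finite R" "\<And>p. p \<in> R \<Longrightarrow> p \<subseteq> T \<and> prefix_closed p \<and> v \<in> p"
    and c: "\<And>t. t \<in> q \<Longrightarrow> prefix v t \<Longrightarrow> ereal c \<le> nrm t (succs q t)"
      "\<And>p t. p \<in> R \<Longrightarrow> t \<in> p \<Longrightarrow> prefix v t \<Longrightarrow> ereal c \<le> nrm t (succs p t)"
    and small: "\<And>t. t \<in> T \<Longrightarrow> prefix v t \<Longrightarrow>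
      1 + 1 / real (length v) \<le> c - log (real (b t)) (real (card (insert q R)))"
  shows "\<exists>q' \<in> EE T nrm. q' \<subseteq> q \<and> (\<forall>p\<in>R. q' \<subseteq> p)"
proof -
  define q' where "q' = {t \<in> \<Inter> (insert q R). prefix t v \<or> prefix v t}"
  have sub: "p \<subseteq> T" if "p \<in> insert q R" for p
    using that R(2) EE_subset[OF q] by auto
  have closed': "prefix_closed p" if "p \<in> insert q R" for p
    using that R(2) q by (auto simp: EE_def)
  have "q' \<in> EE T nrm"
  proof (rule EE_I)
    show "q' \<subseteq> T"
      using EE_subset[OF q] by (auto simp: q'_def)
    show "prefix_closed q'"
      unfolding prefix_closed_def
    proof (intro ballI allI impI)
      fix t u
      assume t: "t \<in> q'" and u: "prefix u t"
      have "u \<in> p" if "p \<in> insert q R" for p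
        using closed'[OF that] that t u unfolding prefix_closed_def q'_def by blast
      moreover have "prefix u v \<or> prefix v u"
        using t u prefix_same_cases[of u t v] prefix_order.trans[of u t v] by (auto simp: q'_def)
      ultimately show "u \<in> q'"
        by (simp add: q'_def)
    qed
    show "v \<in> q'"
      using v(1) R(2) by (auto simp: q'_def)
    show "0 < length v"
      by (rule v(3))
    show "prefix v t" if "splitting q' t" for t
      using that by (rule splitting_comparable) (auto simp: q'_def)
    fix t
    assume t: "t \<in> q'" "prefix v t"
    have tT: "t \<in> T"
      using t EE_subset[OF q] by (auto simp: q'_def)
    have "ereal c - ereal (log (real (b t)) (real (card (insert q R))))
        \<le> nrm t (\<Inter>p\<in>insert q R. succs p t)"
    proof (rule co_big_Inter[OF co_big[OF tT]])
      show "succs p t \<subseteq> succs T t" if "p \<in> insert q R" for p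
        using succs_mono[OF sub[OF that]] .
      show "ereal c \<le> nrm t (succs p t)" if "p \<in> insert q R" for p
        using that c t by (auto simp: q'_def)
    qed (use R(1) in auto)
    also have "(\<Inter>p\<in>insert q R. succs p t) = succs q' t"
      using t(2) by (auto simp: succs_def q'_def)
    finally have "ereal (c - log (real (b t)) (real (card (insert q R)))) \<le> nrm t (succs q' t)"
      by simp
    then show "ereal (1 + 1 / real (length v)) \<le> nrm t (succs q' t)"
      using small[OF tT t(2)] by (meson ereal_less_eq(3) order_trans)
  qed
  moreover have "q' \<subseteq> q \<and> (\<forall>p\<in>R. q' \<subseteq> p)"
    by (auto simp: q'_def)
  ultimately show ?thesis
    by blast
qed

end

section \<open>A common extension below finitely many limits\<close>

theorem theorem4p6:
  fixes T :: "node set" and b :: "node \<Rightarrow> nat" and nrm :: "node \<Rightarrow> node set \<Rightarrow> ereal"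
    and K :: "'k set" and D :: "'k set set" and W :: "'w set" and I :: "'k \<Rightarrow> 'w set"
  assumes frame: "tree_creature_frame T b nrm"
    and log_lim: "filterlim (\<lambda>n. MIN t\<in>Lev n T. log (real n) (real (b t))) at_top sequentially"
    and K: "K \<noteq> {}"
    and D: "ultrafilter_on K D"
    and I: "finite_partition K W I"
  shows "\<exists>L :: node \<Rightarrow> ('w \<Rightarrow> node set) \<Rightarrow> node set.
    (\<forall>s \<in> T - {[]}. \<forall>r \<in> W \<rightarrow>\<^sub>E EE' T b nrm s. L s r \<in> EE T nrm \<and> stem (L s r) = s) \<and>
    (\<forall>(m :: nat) (s :: nat \<Rightarrow> node) (r :: nat \<Rightarrow> 'w \<Rightarrow> node set) a q.
       (\<forall>i<m. s i \<in> T - {[]} \<and> r i \<in> W \<rightarrow>\<^sub>E EE' T b nrm (s i)) \<and>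
       a \<in> D \<and> q \<in> EE T nrm \<and> (\<forall>i<m. q \<subseteq> L (s i) (r i)) \<longrightarrow>
       (\<exists>q' \<in> EE T nrm. q' \<subseteq> q \<and>
          (\<exists>k \<in> a. \<forall>i<m.
             real (card {l \<in> I k. q' \<subseteq> r i l}) / real (card (I k))
               > 1 - 1 / real (length (s i)))))"
proof -
  interpret tree_creature_frame T b nrm
    by (rule frame)
  let ?L = "lim_tree T K D I"
  have I': "\<And>k. k \<in> K \<Longrightarrow> finite (I k) \<and> I k \<noteq> {}"
    using I by (simp add: finite_partition_def)
  have IW: "\<And>k l. k \<in> K \<Longrightarrow> l \<in> I k \<Longrightarrow> l \<in> W"
    using I by (auto simp: finite_partition_def)
  have lim: "?L s r \<in> EE T nrm" "stem (?L s r) = s"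
    if "s \<in> T - {[]}" "r \<in> W \<rightarrow>\<^sub>E EE' T b nrm s" for s and r :: "'w \<Rightarrow> node set"
  proof -
    have s: "s \<in> T" "s \<noteq> []"
      using that(1) by auto
    have r: "\<And>k l. k \<in> K \<Longrightarrow> l \<in> I k \<Longrightarrow> r l \<in> EE' T b nrm s"
      using PiE_mem[OF that(2)] IW by blast
    show "?L s r \<in> EE T nrm"
      by (rule lim_tree_EE(1)[OF D _ _ s]) (fact I' r)+
    show "stem (?L s r) = s"
      by (rule lim_tree_EE(2)[OF D _ _ s]) (fact I' r)+
  qed
  have "\<exists>q' \<in> EE T nrm. q' \<subseteq> q \<and> (\<exists>k \<in> a. \<forall>i<m.
      real (card {l \<in> I k. q' \<subseteq> r i l}) / real (card (I k)) > 1 - 1 / real (length (s i)))"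
    if sr: "\<And>i. i < m \<Longrightarrow> s i \<in> T - {[]} \<and> r i \<in> W \<rightarrow>\<^sub>E EE' T b nrm (s i)"
      and a: "a \<in> D" and q: "q \<in> EE T nrm" and qL: "\<And>i. i < m \<Longrightarrow> q \<subseteq> ?L (s i) (r i)"
    for m :: nat and s :: "nat \<Rightarrow> node" and r :: "nat \<Rightarrow> 'w \<Rightarrow> node set" and a q
  proof (cases "m = 0")
    case True
    \<comment> \<open>With no sequences \<open>q\<close> itself serves, but some \<open>k\<close> in
      \<open>a\<close> is still required.\<close>
    have "a \<noteq> {}"
      using a D by (auto simp: ultrafilter_on_def)
    then show ?thesis
      using True q by auto
  next
    case False
    define \<sigma> where "\<sigma> = stem q"
    \<comment> \<open>The bound \<open>c\<close> holds above \<open>\<sigma>\<close> for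
      \<open>q\<close> and for every tree \<open>r i l\<close>, since each \<open>s i\<close> is a
      prefix of \<open>\<sigma>\<close>.\<close>
    define c where "c = 1 + 1 / real (length \<sigma>)"
    have len_s: "0 < length (s i)" if "i < m" for i
      using sr[OF that] by simp
    \<comment> \<open>The stem of \<open>q\<close> also splits in the larger tree
      \<open>?L (s i) (r i)\<close>, which splits only at or above \<open>s i\<close>.\<close>
    have s_\<sigma>: "prefix (s i) \<sigma>" if "i < m" for i
      using splitting_lim_tree splitting_mono[OF qL[OF that] lim_tree_subset splitting_stem[OF q]]
      by (simp add: \<sigma>_def)
    have len_\<sigma>: "0 < length \<sigma>"
      using len_s[of 0] prefix_length_le[OF s_\<sigma>[of 0]] False by linarith
    have c_le: "c \<le> 1 + 1 / real (length (s i))" if "i < m" for i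
      using prefix_length_le[OF s_\<sigma>[OF that]] len_s[OF that] len_\<sigma>
      by (auto simp: c_def intro!: divide_left_mono)
    have q_norm: "ereal c \<le> nrm t (succs q t)" if "t \<in> q" "prefix \<sigma> t" for t
      using EE_norm[OF q that[unfolded \<sigma>_def]] one_plus_inverse_ereal[OF len_\<sigma>]
      by (simp add: c_def \<sigma>_def)
    have c_pos: "1 < c"
      using len_\<sigma> by (simp add: c_def)
    \<comment> \<open>From length \<open>N\<close> on, intersecting \<open>m + 1\<close> successor
      sets costs at most 1, less than \<open>c\<close>, so a common successor exists. This bound
      does not involve \<open>k\<close>, so \<open>v\<close> can be fixed before
      \<open>k\<close>.\<close>
    obtain N where N: "\<And>t. t \<in> T \<Longrightarrow> N \<le> length t \<Longrightarrow> log (real (b t)) (real (Suc m)) \<le> 1"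
      using log_b_small[of 1 "Suc m"] by auto
    have "\<exists>v. (v \<in> q \<and> prefix \<sigma> v) \<and> length v = max N (length \<sigma>)"
    proof (rule extend_to_length)
      show "\<sigma> \<in> q \<and> prefix \<sigma> \<sigma>"
        using stem_mem[OF q] by (simp add: \<sigma>_def)
      fix t
      assume t: "t \<in> q \<and> prefix \<sigma> t"
      then have "succs q t \<noteq> {}"
        using q_norm[of t] c_pos norm_empty[of t] EE_subset[OF q] by auto
      then show "\<exists>n. t @ [n] \<in> q \<and> prefix \<sigma> (t @ [n])"
        using t by (auto simp: succs_def)
    qed simp
    then obtain v where v: "v \<in> q" "prefix \<sigma> v" "N \<le> length v"
      by auto
    have "{k \<in> K. well_shared (s i) (I k) (r i) v} \<in> D" if "i < m" for i
      using qL[OF that] v prefix_order.trans[OF s_\<sigma>[OF that] v(2)] by (intro lim_treeD) auto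
    then have "K \<inter> (\<Inter>i\<in>{..<m}. {k \<in> K. well_shared (s i) (I k) (r i) v}) \<in> D"
      by (intro ultrafilter_on_Inter[OF D]) auto
    then have "a \<inter> (K \<inter> (\<Inter>i\<in>{..<m}. {k \<in> K. well_shared (s i) (I k) (r i) v})) \<in> D"
      using a D unfolding ultrafilter_on_def by blast
    then have "a \<inter> (K \<inter> (\<Inter>i\<in>{..<m}. {k \<in> K. well_shared (s i) (I k) (r i) v})) \<noteq> {}"
      using D unfolding ultrafilter_on_def by metis
    then obtain k where k: "k \<in> a" "k \<in> K" and shared_v: "\<And>i. i < m \<Longrightarrow> well_shared (s i) (I k) (r i) v"
      by blast
    have r: "r i l \<in> EE' T b nrm (s i)" if "i < m" "l \<in> I k" for i l
      using sr[OF that(1)] IW[OF k(2) that(2)] by (auto simp: PiE_iff)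
    define R where "R = (\<Union>i<m. r i ` I k)"
    have fin_R: "finite R"
      using I'[OF k(2)] by (simp add: R_def)
    \<comment> \<open>The gap between \<open>c\<close> and 1 is \<open>1 / length \<sigma>\<close>.
      Half of it pays for the intersection; the other half covers \<open>1 / length w\<close>,
      whence the demand that \<open>w\<close> have length at least
      \<open>2 * length \<sigma>\<close>.\<close>
    obtain N' where N': "\<And>t. t \<in> T \<Longrightarrow> N' \<le> length t \<Longrightarrow>
        log (real (b t)) (real (card (insert q R))) \<le> 1 / (2 * real (length \<sigma>))"
      using log_b_small[of "1 / (2 * real (length \<sigma>))" "card (insert q R)"] len_\<sigma> by auto
    have "\<exists>w. (w \<in> q \<and> prefix v w \<and> (\<forall>i<m. well_shared (s i) (I k) (r i) w)) \<and>
        length w = max (length v) (max N' (2 * length \<sigma>))"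
    proof (rule extend_to_length)
      show "v \<in> q \<and> prefix v v \<and> (\<forall>i<m. well_shared (s i) (I k) (r i) v)"
        using v shared_v by simp
      fix t
      assume t: "t \<in> q \<and> prefix v t \<and> (\<forall>i<m. well_shared (s i) (I k) (r i) t)"
        and len: "length v \<le> length t"
      have tT: "t \<in> T" and \<sigma>t: "prefix \<sigma> t"
        using t v EE_subset[OF q] prefix_order.trans[of \<sigma> v t] by auto
      \<comment> \<open>Index \<open>m\<close> carries the successors in \<open>q\<close>, the
        smaller indices the well-shared ones, giving \<open>m + 1\<close> sets to be met at
        once.\<close>
      define A where "A i = (if i = m then succs q t
        else {u \<in> succs T t. well_shared (s i) (I k) (r i) u})" for i
      have "ereal c - ereal (log (real (b t)) (real (card {..m}))) \<le> nrm t (\<Inter>i\<in>{..m}. A i)"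
      proof (rule co_big_Inter[OF co_big[OF tT]])
        show "A i \<subseteq> succs T t" if "i \<in> {..m}" for i
          using succs_mono[OF EE_subset[OF q]] by (auto simp: A_def)
        show "ereal c \<le> nrm t (A i)" if "i \<in> {..m}" for i
        proof (cases "i = m")
          case True
          then show ?thesis
            using q_norm t \<sigma>t by (simp add: A_def)
        next
          case False
          then have i: "i < m"
            using that by simp
          have "ereal c \<le> ereal (1 + 1 / real (length (s i)))"
            using c_le[OF i] by simp
          also have "\<dots> \<le> nrm t {u \<in> succs T t. well_shared (s i) (I k) (r i) u}"
            using I'[OF k(2)] t i prefix_order.trans[OF s_\<sigma>[OF i] \<sigma>t]
            by (intro well_shared_step[OF _ _ _ len_s[OF i] tT] r[OF i]) auto
          finally show ?thesis
            using False by (simp add: A_def)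
        qed
      qed auto
      moreover have "0 < c - log (real (b t)) (real (card {..m}))"
        using N[OF tT] v(3) len c_pos by fastforce
      ultimately have "(\<Inter>i\<in>{..m}. A i) \<noteq> {}"
        using norm_empty[OF tT] by auto
      then obtain u where u: "\<And>i. i \<le> m \<Longrightarrow> u \<in> A i"
        by blast
      have "u \<in> succs q t" and "\<forall>i<m. well_shared (s i) (I k) (r i) u"
        using u[of m] u[OF less_imp_le] by (auto simp: A_def)
      then show "\<exists>n. t @ [n] \<in> q \<and> prefix v (t @ [n]) \<and> (\<forall>i<m. well_shared (s i) (I k) (r i) (t @ [n]))"
        using t by (auto simp: succs_def)
    qed simp
    then obtain w where w: "w \<in> q" "prefix v w" "\<And>i. i < m \<Longrightarrow> well_shared (s i) (I k) (r i) w"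
      and len_w: "N' \<le> length w" "2 * length \<sigma> \<le> length w"
      by auto
    have \<sigma>w: "prefix \<sigma> w"
      using v(2) w(2) by (rule prefix_order.trans)
    have "\<exists>q' \<in> EE T nrm. q' \<subseteq> q \<and> (\<forall>p\<in>{p \<in> R. w \<in> p}. q' \<subseteq> p)"
    proof (rule EE_Inter_above[OF q w(1)])
      show "prefix (stem q) w" "0 < length w" "finite {p \<in> R. w \<in> p}"
        using \<sigma>w len_w len_\<sigma> fin_R by (auto simp: \<sigma>_def)
      show "p \<subseteq> T \<and> prefix_closed p \<and> w \<in> p" if "p \<in> {p \<in> R. w \<in> p}" for p
        using that EE'_D(1)[OF r len_s] unfolding R_def EE_def by blast
      show "ereal c \<le> nrm t (succs q t)" if "t \<in> q" "prefix w t" for t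
        using q_norm[OF that(1)] prefix_order.trans[OF \<sigma>w that(2)] .
      show "ereal c \<le> nrm t (succs p t)" if p: "p \<in> {p \<in> R. w \<in> p}" and t: "t \<in> p" "prefix w t" for p t
      proof -
        obtain i l where i: "i < m" "l \<in> I k" "p = r i l"
          using p by (auto simp: R_def)
        have "ereal c \<le> ereal (1 + 1 / real (length (s i)))"
          using c_le[OF i(1)] by simp
        also have "\<dots> \<le> nrm t (succs p t)"
          using EE'_norm[OF r[OF i(1,2)] len_s[OF i(1)]] t i(3)
            prefix_order.trans[OF s_\<sigma>[OF i(1)] prefix_order.trans[OF \<sigma>w t(2)]] by simp
        finally show ?thesis .
      qed
      show "1 + 1 / real (length w) \<le> c - log (real (b t)) (real (card (insert q {p \<in> R. w \<in> p})))"
        if t: "t \<in> T" "prefix w t" for t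
      proof -
        have bt: "1 < real (b t)"
          using co_big[OF t(1)] by (simp add: co_big_def)
        \<comment> \<open>\<open>N'\<close> was chosen for all of \<open>R\<close>, before
          \<open>w\<close> was known; keeping only the trees through \<open>w\<close> can only lower
          the cost.\<close>
        have "card (insert q {p \<in> R. w \<in> p}) \<le> card (insert q R)"
          using fin_R by (intro card_mono) auto
        moreover have "0 < card (insert q {p \<in> R. w \<in> p})"
          using fin_R by (simp add: card_gt_0_iff)
        ultimately have "log (real (b t)) (real (card (insert q {p \<in> R. w \<in> p})))
            \<le> log (real (b t)) (real (card (insert q R)))"
          using bt by simp
        also have "\<dots> \<le> 1 / (2 * real (length \<sigma>))"
          using N'[OF t(1)] len_w(1) prefix_length_le[OF t(2)] by linarith
        moreover have "1 / real (length w) \<le> 1 / (2 * real (length \<sigma>))"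
          using len_w(2) len_\<sigma> by (intro frac_le) linarith+
        ultimately show ?thesis
          by (simp add: c_def)
      qed
    qed
    then obtain q' where q': "q' \<in> EE T nrm" "q' \<subseteq> q" and below: "\<And>p. p \<in> R \<Longrightarrow> w \<in> p \<Longrightarrow> q' \<subseteq> p"
      by blast
    have "1 - 1 / real (length (s i)) < real (card {l \<in> I k. q' \<subseteq> r i l}) / real (card (I k))"
      if i: "i < m" for i
    proof -
      \<comment> \<open>Every \<open>r i l\<close> through \<open>w\<close> contains
        \<open>q'\<close>, so the share of \<open>w\<close> is a lower bound for the fraction
        sought.\<close>
      have "1 - 1 / real (length (s i)) < share (I k) (r i) w"
        using threshold_ge[OF len_s[OF i], of "length w"] w(3)[OF i] by (simp add: well_shared_def)
      also have "\<dots> \<le> real (card {l \<in> I k. q' \<subseteq> r i l}) / real (card (I k))"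
      proof -
        have "{l \<in> I k. w \<in> r i l} \<subseteq> {l \<in> I k. q' \<subseteq> r i l}"
          using below i unfolding R_def by blast
        then show ?thesis
          unfolding share_def using I'[OF k(2)]
          by (intro divide_right_mono of_nat_mono card_mono) auto
      qed
      finally show ?thesis .
    qed
    then show ?thesis
      using q' k(1) by blast
  qed
  note main = this
  show ?thesis
  proof (intro exI[of _ ?L] conjI ballI allI impI)
    fix s and r :: "'w \<Rightarrow> node set"
    assume "s \<in> T - {[]}" "r \<in> W \<rightarrow>\<^sub>E EE' T b nrm s"
    then show "?L s r \<in> EE T nrm" "stem (?L s r) = s"
      by (fact lim)+
  next
    fix m :: nat and s :: "nat \<Rightarrow> node" and r :: "nat \<Rightarrow> 'w \<Rightarrow> node set" and a q
    assume "(\<forall>i<m. s i \<in> T - {[]} \<and> r i \<in> W \<rightarrow>\<^sub>E EE' T b nrm (s i)) \<and>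
      a \<in> D \<and> q \<in> EE T nrm \<and> (\<forall>i<m. q \<subseteq> ?L (s i) (r i))"
    then show "\<exists>q' \<in> EE T nrm. q' \<subseteq> q \<and> (\<exists>k \<in> a. \<forall>i<m.
        real (card {l \<in> I k. q' \<subseteq> r i l}) / real (card (I k)) > 1 - 1 / real (length (s i)))"
      by (intro main) simp_all
  qed
qed

end
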